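(* Let $(K,\Sigma)$ be a tight FFCC pair for $\mathbf H$ and $\bar t=\langle t_n:n<\omega\rangle\in\mathrm{PC}^{\mathtt{tt}}_\infty(K,\Sigma)$. Let $\bar D=\langle D_n:n<\omega\rangle\in\mathrm{suf}^+_{\bar t}$ satisfy $\bar D\circledast\bar D=\bar D$, and let $A_n\in D_n$ for $n<\omega$. Then there are sequences $\langle n_i:i<\omega\rangle$, $\langle g_{3i},g_{3i+2}:i<\omega\rangle$ and $\langle s_{3i+1}:i<\omega\rangle$ such that for every $i<\omega$: ($\alpha$) $0=n_0\le n_{3i}\le n_{3i+1}<n_{3i+2}\le n_{3i+3}<\omega$; ($\beta$) if $j=3i$ or $j=3i+2$, then $g_j\in\mathrm{pos}(\bar t\upharpoonright[n_j,n_{j+1}))$; ($\gamma$) if $j=3i+1$, then $s_j\in\Sigma(t_{n_j},\dots,t_{n_{j+1}-1})$ and $\mathrm{nor}[s_j]\ge j$; ($\delta$) if $i<k<\omega$ and $g_{3\ell+1}\in\mathrm{val}[s_{3\ell+1}]$ for all $\ell\in[i,k)$, then $\bigcup_{j=3i}^{3k-1}g_j\in A_{n_{3i}}$.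
   Context: Notation: an integer $n$ is identified with $\{0,\dots,n-1\}$; $[n,m)=\{k\in\omega:n\le k<m\}$. Fix $\mathbf H$ with domain $\omega$, each $\mathbf H(i)$ finite non-empty; $\mathcal F_{\mathbf H}$ is the set of finite non-empty functions $f$ with $\mathrm{dom}(f)\subseteq\omega$, $f(i)\in\mathbf H(i)$. An FP creature for $\mathbf H$ is a tuple $t=(\mathrm{nor}[t],\mathrm{val}[t],\mathrm{dis}[t],m^t_{\mathrm{dn}},m^t_{\mathrm{up}})$ with $\mathrm{nor}[t]\ge0$ real, $\mathrm{dis}[t]$ arbitrary, $m^t_{\mathrm{dn}}<m^t_{\mathrm{up}}<\omega$, $\mathrm{val}[t]$ a non-empty finite subset of $\mathcal F_{\mathbf H}$ whose members have domains inside $[m^t_{\mathrm{dn}},m^t_{\mathrm{up}})$. A tight FFCC pair for $\mathbf H$ is a pair $(K,\Sigma)$ with: $K$ a countable family of FP creatures for $\mathbf H$; for each $m$, $\{t\in K:m^t_{\mathrm{up}}\le m\}$ finite and $\{t\in K:m^t_{\mathrm{dn}}\ge m,\ \mathrm{nor}[t]\ge m\}$ infinite; $\Sigma$ a function defined exactly on the finite sequences $(t_0,\dots,t_n)$ of members of $K$ with $m^{t_\ell}_{\mathrm{up}}=m^{t_{\ell+1}}_{\mathrm{dn}}$ ($\ell<n$), with values non-empty subsets of $K$; if $t\in\Sigma(t_0,\dots,t_n)$ then $m^t_{\mathrm{dn}}=m^{t_0}_{\mathrm{dn}}$, $m^t_{\mathrm{up}}=m^{t_n}_{\mathrm{up}}$,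 and every $f\in\mathrm{val}[t]$ has $\mathrm{dom}(f)\subseteq\bigcup_{\ell\le n}[m^{t_\ell}_{\mathrm{dn}},m^{t_\ell}_{\mathrm{up}})$ and $f\upharpoonright[m^{t_\ell}_{\mathrm{dn}},m^{t_\ell}_{\mathrm{up}})\in\mathrm{val}[t_\ell]$ for all $\ell\le n$; $t\in\Sigma(t)$ for $t\in K$; if $\bar t_0,\dots,\bar t_n\in\mathrm{dom}(\Sigma)$ and their concatenation $\bar t\in\mathrm{dom}(\Sigma)$ then $\Sigma(s_0,\dots,s_n)\subseteq\Sigma(\bar t)$ whenever $s_\ell\in\Sigma(\bar t_\ell)$; and if $s_0,s_1\in K$, $m^{s_0}_{\mathrm{up}}=m^{s_1}_{\mathrm{dn}}$, $f_0\in\mathrm{val}[s_0]$, $f_1\in\mathrm{val}[s_1]$, then $f_0\cup f_1\in\mathrm{val}[s]$ for some $s\in\Sigma(s_0,s_1)$. Outside $\mathrm{dom}(\Sigma)$ set $\Sigma(\cdot)=\emptyset$. $\mathrm{PC}^{\mathtt{tt}}_\infty(K,\Sigma)$ is the set of sequences $\bar t=\langle t_n\rangle$ of members of $K$ with $m^{t_n}_{\mathrm{up}}=m^{t_{n+1}}_{\mathrm{dn}}$ and $\lim_n\mathrm{nor}[t_n]=\infty$. $\bar t\upharpoonleft n=\langle t_{n+k}:k<\omega\rangle$; $\Sigma^{\mathtt{tt}}(\bar t)=\bigcup_n\Sigma(t_0,\dots,t_n)$; $\mathrm{pos}^{\mathtt{tt}}(\bar t)=\bigcup\{\mathrm{val}[s]:s\in\Sigma^{\mathtt{tt}}(\bar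 t)\}$. For $n<m$, $\mathrm{pos}(\bar t\upharpoonright[n,m))=\bigcup\{\mathrm{val}[s]:s\in\Sigma(t_n,\dots,t_{m-1})\}$; $\mathrm{pos}(\bar t\upharpoonright[n,n))=\{\emptyset\}$. For $f\in\mathrm{pos}^{\mathtt{tt}}(\bar t\upharpoonleft n)$, $x_f$ is the unique $m>n$ with $f\in\mathrm{val}[s]$ for some $s\in\Sigma(t_n,\dots,t_{m-1})$; for $A\subseteq\mathcal F_{\mathbf H}$, $f\circledast A=\{g\in\mathrm{pos}^{\mathtt{tt}}(\bar t\upharpoonleft x_f):f\cup g\in A\}$. $\mathrm{suf}_{\bar t}$ is the set of sequences $\bar D=\langle D_n\rangle$ with each $D_n$ a non-principal ultrafilter on $\mathrm{pos}^{\mathtt{tt}}(\bar t\upharpoonleft n)$. $\mathrm{set}^n_{\bar t}(A,\bar D)=\{f\in\mathrm{pos}^{\mathtt{tt}}(\bar t\upharpoonleft n):f\circledast A\in D_{x_f}\}$ for $A\subseteq\mathrm{pos}^{\mathtt{tt}}(\bar t\upharpoonleft n)$. $\bar D^1\circledast\bar D^2=\langle D_n\rangle$ with $D_n=\{A\subseteq\mathrm{pos}^{\mathtt{tt}}(\bar t\upharpoonleft n):\mathrm{set}^n_{\bar t}(A,\bar D^1)\in D^2_n\}$. $\mathcal C^n_{\bar t}$ is the family of $B\subseteq\mathrm{pos}^{\mathtt{tt}}(\bar t\upharpoonleft n)$ for which there is $M$ such that: whenever $i_0=n\le i_1<i_2\le i_3$, $g_0\in\mathrm{pos}(\bar t\upharpoonright[i_0,i_1))$,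 $g_2\in\mathrm{pos}(\bar t\upharpoonright[i_2,i_3))$, $s\in\Sigma(t_{i_1},\dots,t_{i_2-1})$ and $\mathrm{nor}[s]\ge M$, we have $B\cap\{g_0\cup g_1\cup g_2:g_1\in\mathrm{val}[s]\}\ne\emptyset$. $\mathrm{suf}^+_{\bar t}$ is the set of $\bar D\in\mathrm{suf}_{\bar t}$ with $\mathcal C^n_{\bar t}\subseteq D_n$ for all $n$. *)

theory Defs
  imports Complex_Main "HOL-Library.Countable_Set"
begin

text \<open>
  Partial functions with domain inside \<open>\<omega>\<close> are maps of type \<open>nat \<rightharpoonup> 'a\<close>. The union \<open>f \<union> g\<close> of two
  functions is written \<open>f ++ g\<close>; in every use below the domains of the functions
  being united are pairwise disjoint (they lie in disjoint intervals), so the order of the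
  arguments is irrelevant.
\<close>

definition fin_funs :: "(nat \<Rightarrow> 'a set) \<Rightarrow> (nat \<rightharpoonup> 'a) set" where
  "fin_funs H = {f. finite (dom f) \<and> dom f \<noteq> {} \<and> (\<forall>i\<in>dom f. the (f i) \<in> H i)}"

record ('a, 'd) creature =
  nor :: real
  val :: "(nat \<rightharpoonup> 'a) set"
  dis :: 'd
  mdn :: nat
  mup :: nat

definition FP_creature :: "(nat \<Rightarrow> 'a set) \<Rightarrow> ('a, 'd) creature \<Rightarrow> bool" where
  "FP_creature H t \<longleftrightarrow>
     nor t \<ge> 0 \<and> mdn t < mup t \<and>
     finite (val t) \<and> val t \<noteq> {} \<and> val t \<subseteq> fin_funs H \<and>
     (\<forall>f\<in>val t. dom f \<subseteq> {mdn t..<mup t})"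

text \<open>The finite sequences on which the composition operation is to be defined.\<close>

definition composable :: "('a, 'd) creature set \<Rightarrow> ('a, 'd) creature list \<Rightarrow> bool" where
  "composable K ts \<longleftrightarrow>
     ts \<noteq> [] \<and> set ts \<subseteq> K \<and> successively (\<lambda>s t. mup s = mdn t) ts"

text \<open>
  The partial operation \<open>\<Sigma>\<close> is a total function \<open>Sig\<close> on lists with value \<open>{}\<close> off the intended
  domain. Since its values on the domain are non-empty, \<open>dom(\<Sigma>)\<close> can be
  recovered as \<open>{ts. Sig ts \<noteq> {}}\<close>.
\<close>

definition tight_FFCC ::
  "(nat \<Rightarrow> 'a set) \<Rightarrow> ('a, 'd) creature set \<Rightarrow>
   (('a, 'd) creature list \<Rightarrow> ('a, 'd) creature set) \<Rightarrow> bool" where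
  "tight_FFCC H K Sig \<longleftrightarrow>
     countable K \<and> (\<forall>t\<in>K. FP_creature H t) \<and>
     (\<forall>m. finite {t\<in>K. mup t \<le> m}) \<and>
     (\<forall>m. infinite {t\<in>K. mdn t \<ge> m \<and> nor t \<ge> real m}) \<and>
     (\<forall>ts. composable K ts \<longrightarrow> Sig ts \<noteq> {} \<and> Sig ts \<subseteq> K) \<and>
     (\<forall>ts. \<not> composable K ts \<longrightarrow> Sig ts = {}) \<and>
     (\<forall>ts t. composable K ts \<and> t \<in> Sig ts \<longrightarrow>
        mdn t = mdn (hd ts) \<and> mup t = mup (last ts) \<and>
        (\<forall>f\<in>val t.
           dom f \<subseteq> (\<Union>r\<in>set ts. {mdn r..<mup r}) \<and>
           (\<forall>r\<in>set ts. f |` {mdn r..<mup r} \<in> val r))) \<and>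
     (\<forall>t\<in>K. t \<in> Sig [t]) \<and>
     (\<forall>tss ss. tss \<noteq> [] \<and> (\<forall>ts\<in>set tss. composable K ts) \<and> composable K (concat tss) \<and>
        list_all2 (\<lambda>s ts. s \<in> Sig ts) ss tss \<longrightarrow> Sig ss \<subseteq> Sig (concat tss)) \<and>
     (\<forall>s0\<in>K. \<forall>s1\<in>K. mup s0 = mdn s1 \<longrightarrow>
        (\<forall>f0\<in>val s0. \<forall>f1\<in>val s1. \<exists>s\<in>Sig [s0, s1]. f0 ++ f1 \<in> val s))"

definition PC_tt :: "('a, 'd) creature set \<Rightarrow> (nat \<Rightarrow> ('a, 'd) creature) set" where
  "PC_tt K = {t. (\<forall>n. t n \<in> K) \<and> (\<forall>n. mup (t n) = mdn (t (Suc n))) \<and>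
                 filterlim (\<lambda>n. nor (t n)) at_top sequentially}"

definition tail :: "(nat \<Rightarrow> 'b) \<Rightarrow> nat \<Rightarrow> nat \<Rightarrow> 'b" where
  "tail t n = (\<lambda>k. t (n + k))"

text \<open>The finite sequence \<open>(t\<^sub>n, \<dots>, t\<^sub>m\<^sub>-\<^sub>1)\<close>, empty if \<open>m \<le> n\<close>.\<close>

definition seg :: "(nat \<Rightarrow> 'b) \<Rightarrow> nat \<Rightarrow> nat \<Rightarrow> 'b list" where
  "seg t n m = map t [n..<m]"

definition Sigma_tt ::
  "(('a, 'd) creature list \<Rightarrow> ('a, 'd) creature set) \<Rightarrow>
   (nat \<Rightarrow> ('a, 'd) creature) \<Rightarrow> ('a, 'd) creature set" where
  "Sigma_tt Sig t = (\<Union>n. Sig (seg t 0 (Suc n)))"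

definition pos_tt ::
  "(('a, 'd) creature list \<Rightarrow> ('a, 'd) creature set) \<Rightarrow>
   (nat \<Rightarrow> ('a, 'd) creature) \<Rightarrow> (nat \<rightharpoonup> 'a) set" where
  "pos_tt Sig t = (\<Union>s\<in>Sigma_tt Sig t. val s)"

text \<open>\<open>pos(t \<restriction> [n,m))\<close>, meant for \<open>n \<le> m\<close>.\<close>

definition pos_seg ::
  "(('a, 'd) creature list \<Rightarrow> ('a, 'd) creature set) \<Rightarrow>
   (nat \<Rightarrow> ('a, 'd) creature) \<Rightarrow> nat \<Rightarrow> nat \<Rightarrow> (nat \<rightharpoonup> 'a) set" where
  "pos_seg Sig t n m = (if n = m then {Map.empty} else (\<Union>s\<in>Sig (seg t n m). val s))"

text \<open>
  \<open>xend Sig t n f\<close> is \<open>x\<^sub>f\<close> for \<open>f\<close> in \<open>pos_tt Sig (tail t n)\<close>; the level \<open>n\<close> is an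
  explicit argument here and in the operations that depend on \<open>x\<^sub>f\<close>.
\<close>

definition xend ::
  "(('a, 'd) creature list \<Rightarrow> ('a, 'd) creature set) \<Rightarrow>
   (nat \<Rightarrow> ('a, 'd) creature) \<Rightarrow> nat \<Rightarrow> (nat \<rightharpoonup> 'a) \<Rightarrow> nat" where
  "xend Sig t n f = (THE m. n < m \<and> (\<exists>s\<in>Sig (seg t n m). f \<in> val s))"

definition circ ::
  "(('a, 'd) creature list \<Rightarrow> ('a, 'd) creature set) \<Rightarrow>
   (nat \<Rightarrow> ('a, 'd) creature) \<Rightarrow> nat \<Rightarrow> (nat \<rightharpoonup> 'a) \<Rightarrow> (nat \<rightharpoonup> 'a) set \<Rightarrow> (nat \<rightharpoonup> 'a) set" where
  "circ Sig t n f A = {g \<in> pos_tt Sig (tail t (xend Sig t n f)). f ++ g \<in> A}"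

definition ultrafilter_on :: "'b set \<Rightarrow> 'b set set \<Rightarrow> bool" where
  "ultrafilter_on X D \<longleftrightarrow>
     D \<subseteq> Pow X \<and> X \<in> D \<and> {} \<notin> D \<and>
     (\<forall>A\<in>D. \<forall>B\<in>D. A \<inter> B \<in> D) \<and>
     (\<forall>A\<in>D. \<forall>B. A \<subseteq> B \<and> B \<subseteq> X \<longrightarrow> B \<in> D) \<and>
     (\<forall>A. A \<subseteq> X \<longrightarrow> A \<in> D \<or> X - A \<in> D)"

definition nonprincipal_ultrafilter_on :: "'b set \<Rightarrow> 'b set set \<Rightarrow> bool" where
  "nonprincipal_ultrafilter_on X D \<longleftrightarrow> ultrafilter_on X D \<and> (\<forall>x\<in>X. {x} \<notin> D)"

definition suf ::
  "(('a, 'd) creature list \<Rightarrow> ('a, 'd) creature set) \<Rightarrow>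
   (nat \<Rightarrow> ('a, 'd) creature) \<Rightarrow> (nat \<Rightarrow> (nat \<rightharpoonup> 'a) set set) set" where
  "suf Sig t = {D. \<forall>n. nonprincipal_ultrafilter_on (pos_tt Sig (tail t n)) (D n)}"

definition set_op ::
  "(('a, 'd) creature list \<Rightarrow> ('a, 'd) creature set) \<Rightarrow>
   (nat \<Rightarrow> ('a, 'd) creature) \<Rightarrow> nat \<Rightarrow> (nat \<rightharpoonup> 'a) set \<Rightarrow>
   (nat \<Rightarrow> (nat \<rightharpoonup> 'a) set set) \<Rightarrow> (nat \<rightharpoonup> 'a) set" where
  "set_op Sig t n A D =
     {f \<in> pos_tt Sig (tail t n). circ Sig t n f A \<in> D (xend Sig t n f)}"

definition uf_prod ::
  "(('a, 'd) creature list \<Rightarrow> ('a, 'd) creature set) \<Rightarrow>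
   (nat \<Rightarrow> ('a, 'd) creature) \<Rightarrow> (nat \<Rightarrow> (nat \<rightharpoonup> 'a) set set) \<Rightarrow>
   (nat \<Rightarrow> (nat \<rightharpoonup> 'a) set set) \<Rightarrow> (nat \<Rightarrow> (nat \<rightharpoonup> 'a) set set)" where
  "uf_prod Sig t D1 D2 =
     (\<lambda>n. {A. A \<subseteq> pos_tt Sig (tail t n) \<and> set_op Sig t n A D1 \<in> D2 n})"

definition C_family ::
  "(('a, 'd) creature list \<Rightarrow> ('a, 'd) creature set) \<Rightarrow>
   (nat \<Rightarrow> ('a, 'd) creature) \<Rightarrow> nat \<Rightarrow> (nat \<rightharpoonup> 'a) set set" where
  "C_family Sig t n =
     {B. B \<subseteq> pos_tt Sig (tail t n) \<and>
         (\<exists>M::real. \<forall>i1 i2 i3. n \<le> i1 \<and> i1 < i2 \<and> i2 \<le> i3 \<longrightarrow>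
            (\<forall>g0\<in>pos_seg Sig t n i1. \<forall>g2\<in>pos_seg Sig t i2 i3. \<forall>s\<in>Sig (seg t i1 i2).
               nor s \<ge> M \<longrightarrow> B \<inter> {g0 ++ g1 ++ g2 | g1. g1 \<in> val s} \<noteq> {}))}"

definition suf_plus ::
  "(('a, 'd) creature list \<Rightarrow> ('a, 'd) creature set) \<Rightarrow>
   (nat \<Rightarrow> ('a, 'd) creature) \<Rightarrow> (nat \<Rightarrow> (nat \<rightharpoonup> 'a) set set) set" where
  "suf_plus Sig t = {D \<in> suf Sig t. \<forall>n. C_family Sig t n \<subseteq> D n}"

text \<open>The union of the functions \<open>g\<^sub>j\<close> for \<open>a \<le> j < b\<close>.\<close>

definition seq_union :: "(nat \<Rightarrow> (nat \<rightharpoonup> 'a)) \<Rightarrow> nat \<Rightarrow> nat \<Rightarrow> (nat \<rightharpoonup> 'a)" where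
  "seq_union g a b = foldr (++) (map g [a..<b]) Map.empty"

end

theory Submission
  imports Defs
begin

text \<open>
  This is the Galvin--Glazer argument for idempotent ultrafilters. If \<open>A \<in> D\<^sub>n\<close> then, by idempotence, the set of
  \<open>f \<in> A\<close> with \<open>f \<circledast> A \<in> D\<^bsub>x\<^sub>f\<^esub>\<close> is again in \<open>D\<^sub>n\<close>, and it reproduces this property: it is \<^emph>\<open>stable\<close>.
  As the complement of a set \<open>B \<in> D\<^sub>n\<close> is not in \<open>C\<^sup>n\<close>, there are \<open>g\<^sub>0\<close>, \<open>s\<close>, \<open>g\<^sub>2\<close> with \<open>nor s\<close> as large
  as desired such that \<open>g\<^sub>0 \<union> g\<^sub>1 \<union> g\<^sub>2 \<in> B\<close> for every \<open>g\<^sub>1 \<in> val s\<close>. Starting from a stable \<open>B\<^sub>i \<subseteq> A\<^bsub>n\<^sub>3\<^sub>i\<^esub>\<close>,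
  choose such a block and let \<open>B\<^sub>i\<^sub>+\<^sub>1\<close> be a stable subset of \<open>A\<^bsub>n\<^sub>3\<^sub>i\<^sub>+\<^sub>3\<^esub>\<close> and of the finitely many sets
  \<open>(g\<^sub>0 \<union> g\<^sub>1 \<union> g\<^sub>2) \<circledast> B\<^sub>i\<close>. Then every union of blocks from the \<open>i\<close>-th on lies in \<open>B\<^sub>i\<close>.
\<close>

section \<open>Segments of a sequence and the possibilities over them\<close>

lemma hd_seg: "n < m \<Longrightarrow> hd (seg t n m) = t n"
  by (simp add: seg_def upt_conv_Cons)

lemma last_seg: "n < m \<Longrightarrow> last (seg t n m) = t (m - 1)"
  by (simp add: seg_def last_map)

lemma set_seg: "set (seg t n m) = t ` {n..<m}"
  by (simp add: seg_def)

lemma seg_append: "n \<le> m \<Longrightarrow> m \<le> k \<Longrightarrow> seg t n m @ seg t m k = seg t n k"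
  unfolding seg_def by (metis map_append le_Suc_ex upt_add_eq_append)

lemma seg_tail: "seg (tail t n) 0 (Suc k) = seg t n (Suc (n + k))"
  by (rule nth_equalityI) (auto simp: seg_def tail_def simp del: upt_Suc)

lemma pos_seg_less: "n < m \<Longrightarrow> pos_seg Sig t n m = (\<Union>s\<in>Sig (seg t n m). val s)"
  by (simp add: pos_seg_def)

text \<open>Shifting by \<open>n\<close> turns the initial segments of \<open>tail t n\<close> into
  the segments of \<open>t\<close> that start at \<open>n\<close>, and \<open>Suc (n + k)\<close>
  runs through all end points above \<open>n\<close>. Later arguments can thus work with
  \<open>pos_seg\<close> alone.\<close>

lemma pos_tt_eq_pos_seg: "pos_tt Sig (tail t n) = (\<Union>m\<in>{n<..}. pos_seg Sig t n m)"
proof -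
  have "{n<..} = range (\<lambda>k. Suc (n + k))"
    by (auto simp: image_iff) (metis less_iff_Suc_add)
  then have "(\<Union>m\<in>{n<..}. pos_seg Sig t n m) = (\<Union>k. pos_seg Sig t n (Suc (n + k)))"
    by (simp only: image_image)
  then show ?thesis
    by (simp add: pos_tt_def Sigma_tt_def seg_tail pos_seg_less)
qed

lemma pos_seg_refl: "pos_seg Sig t n n = {Map.empty}"
  by (simp add: pos_seg_def)

lemma seq_union_block:
  assumes "i < k"
  shows "seq_union G (3 * i) (3 * k) =
    (G (3*i) ++ G (3*i+1) ++ G (3*i+2)) ++ seq_union G (3 * Suc i) (3 * k)"
proof -
  have "[3*i..<3*k] = 3*i # (3*i+1) # (3*i+2) # [3 * Suc i..<3*k]"
    using assms by (simp add: upt_conv_Cons) (simp add: numeral_3_eq_3)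
  then show ?thesis by (simp add: seq_union_def)
qed

section \<open>End points and concatenation of possibilities\<close>

locale tight_sequence =
  fixes H :: "nat \<Rightarrow> 'a set"
    and K :: "('a, 'd) creature set"
    and Sig :: "('a, 'd) creature list \<Rightarrow> ('a, 'd) creature set"
    and t :: "nat \<Rightarrow> ('a, 'd) creature"
  assumes tight: "tight_FFCC H K Sig"
    and PC: "t \<in> PC_tt K"
begin

abbreviation "P n \<equiv> pos_tt Sig (tail t n)"
abbreviation "pos \<equiv> pos_seg Sig t"
abbreviation "x \<equiv> xend Sig t"

lemma t_in: "t n \<in> K"
  using PC by (simp add: PC_tt_def)

lemma mup_t: "mup (t n) = mdn (t (Suc n))"
  using PC by (simp add: PC_tt_def)

lemma creature: "s \<in> K \<Longrightarrow> FP_creature H s"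
  using tight by (simp add: tight_FFCC_def)

lemma mup_le_mdn:
  assumes "k < l"
  shows "mup (t k) \<le> mdn (t l)"
  using assms
proof (induction l)
  case (Suc l)
  have "mdn (t l) < mup (t l)"
    using creature[OF t_in] by (auto simp: FP_creature_def)
  with Suc show ?case by (auto simp: mup_t[symmetric] less_Suc_eq)
qed simp

lemma composable_seg:
  assumes "n < m"
  shows "composable K (seg t n m)"
proof -
  have "successively (\<lambda>s t. mup s = mdn t) (map t [n..<m])"
    by (auto simp: successively_conv_nth mup_t)
  then show ?thesis
    using assms t_in by (auto simp: composable_def seg_def)
qed

lemma SigD:
  assumes "composable K ts" "s \<in> Sig ts"
  shows "s \<in> K" "mdn s = mdn (hd ts)" "mup s = mup (last ts)"
    "f \<in> val s \<Longrightarrow> dom f \<subseteq> (\<Union>r\<in>set ts. {mdn r..<mup r})"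
    "f \<in> val s \<Longrightarrow> r \<in> set ts \<Longrightarrow> f |` {mdn r..<mup r} \<in> val r"
proof -
  have "\<forall>ts. composable K ts \<longrightarrow> Sig ts \<noteq> {} \<and> Sig ts \<subseteq> K"
    using tight unfolding tight_FFCC_def by (elim conjE)
  then show "s \<in> K" using assms by blast
  have "\<forall>ts t. composable K ts \<and> t \<in> Sig ts \<longrightarrow>
      mdn t = mdn (hd ts) \<and> mup t = mup (last ts) \<and>
      (\<forall>f\<in>val t. dom f \<subseteq> (\<Union>r\<in>set ts. {mdn r..<mup r}) \<and>
        (\<forall>r\<in>set ts. f |` {mdn r..<mup r} \<in> val r))"
    using tight unfolding tight_FFCC_def by (elim conjE)
  note * = this[rule_format, OF conjI, OF assms]
  from * show "mdn s = mdn (hd ts)" "mup s = mup (last ts)" by simp_all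
  from * show "dom f \<subseteq> (\<Union>r\<in>set ts. {mdn r..<mup r})" if "f \<in> val s"
    using that by simp
  from * show "f |` {mdn r..<mup r} \<in> val r" if "f \<in> val s" "r \<in> set ts"
    using that by simp
qed

lemma Sig_seg_in: "n < m \<Longrightarrow> s \<in> Sig (seg t n m) \<Longrightarrow> s \<in> K"
  using SigD(1)[OF composable_seg] .

lemma finite_val: "n < m \<Longrightarrow> s \<in> Sig (seg t n m) \<Longrightarrow> finite (val s)"
  using creature[OF Sig_seg_in] by (auto simp: FP_creature_def)

text \<open>By the second membership, \<open>f\<close> restricts on the interval of
  \<open>t (m' - 1)\<close> to a member of its \<open>val\<close>, which is a non-empty function. So
  \<open>f\<close> has a point beyond all intervals of \<open>t l\<close> with \<open>l < m\<close>,
  against the first. This makes \<open>xend\<close> well defined.\<close>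

lemma pos_seg_end_unique:
  assumes "n < m" "m < m'" "f \<in> pos n m" "f \<in> pos n m'"
  shows False
proof -
  obtain s s' where s: "s \<in> Sig (seg t n m)" "f \<in> val s"
    and s': "s' \<in> Sig (seg t n m')" "f \<in> val s'"
    using assms by (auto simp: pos_seg_less)
  let ?r = "t (m' - 1)"
  have "?r \<in> set (seg t n m')"
    using assms(1,2) by (auto simp: set_seg)
  then have "f |` {mdn ?r..<mup ?r} \<in> val ?r"
    using SigD(5)[OF composable_seg s'] assms(1,2) by simp
  then have "dom (f |` {mdn ?r..<mup ?r}) \<noteq> {}"
    using creature[OF t_in[of "m' - 1"]] unfolding FP_creature_def fin_funs_def by blast
  then obtain i where i: "i \<in> dom f" "mdn ?r \<le> i"
    unfolding dom_restrict by (metis IntE atLeastLessThan_iff ex_in_conv)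
  obtain l where l: "l < m" "i < mup (t l)"
    using SigD(4)[OF composable_seg[OF assms(1)] s] i(1) unfolding set_seg by fastforce
  have "mup (t l) \<le> mdn ?r"
    using mup_le_mdn l(1) assms(2) by simp
  with i(2) l(2) show False by simp
qed

lemma xend_eq:
  assumes "n < m" "f \<in> pos n m"
  shows "x n f = m"
  unfolding xend_def
proof (rule the_equality)
  show "n < m \<and> (\<exists>s\<in>Sig (seg t n m). f \<in> val s)"
    using assms by (auto simp: pos_seg_less)
  fix m' assume "n < m' \<and> (\<exists>s\<in>Sig (seg t n m'). f \<in> val s)"
  then have "n < m'" "f \<in> pos n m'" by (auto simp: pos_seg_less)
  then show "m' = m"
    using pos_seg_end_unique[of n m m' f] pos_seg_end_unique[of n m' m f] assms
    by (metis linorder_neqE_nat)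
qed

lemma pos_ttE:
  assumes "f \<in> P n"
  obtains "n < x n f" "f \<in> pos n (x n f)"
proof -
  obtain m where "n < m" "f \<in> pos n m"
    using assms by (auto simp: pos_tt_eq_pos_seg)
  then show ?thesis using xend_eq that by metis
qed

lemma pos_seg_subset: "n < m \<Longrightarrow> pos n m \<subseteq> P n"
  by (auto simp: pos_tt_eq_pos_seg)

text \<open>The last clause of tightness finds \<open>f ++ g\<close> in some
  \<open>s \<in> Sig [s0, s1]\<close>; the concatenation clause then moves \<open>s\<close> into
  \<open>Sig (seg t n k)\<close>.\<close>

lemma pos_seg_add_less:
  assumes "n < m" "m < k" "f \<in> pos n m" "g \<in> pos m k"
  shows "f ++ g \<in> pos n k"
proof -
  obtain s0 s1 where s0: "s0 \<in> Sig (seg t n m)" "f \<in> val s0"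
    and s1: "s1 \<in> Sig (seg t m k)" "g \<in> val s1"
    using assms by (auto simp: pos_seg_less)
  note c0 = composable_seg[OF assms(1)] and c1 = composable_seg[OF assms(2)]
  have "mup s0 = mdn s1"
    using SigD(3)[OF c0 s0(1)] SigD(2)[OF c1 s1(1)] assms(1,2) mup_t[of "m - 1"]
    by (simp add: hd_seg last_seg)
  moreover have "\<forall>s0\<in>K. \<forall>s1\<in>K. mup s0 = mdn s1 \<longrightarrow>
      (\<forall>f0\<in>val s0. \<forall>f1\<in>val s1. \<exists>s\<in>Sig [s0, s1]. f0 ++ f1 \<in> val s)"
    using tight unfolding tight_FFCC_def by (elim conjE)
  ultimately obtain s where s: "s \<in> Sig [s0, s1]" "f ++ g \<in> val s"
    using s0(2) s1(2) SigD(1)[OF c0 s0(1)] SigD(1)[OF c1 s1(1)] by blast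
  have cc: "concat [seg t n m, seg t m k] = seg t n k"
    using assms(1,2) by (simp add: seg_append)
  have "\<forall>tss ss. tss \<noteq> [] \<and> (\<forall>ts\<in>set tss. composable K ts) \<and> composable K (concat tss) \<and>
      list_all2 (\<lambda>s ts. s \<in> Sig ts) ss tss \<longrightarrow> Sig ss \<subseteq> Sig (concat tss)"
    using tight unfolding tight_FFCC_def by (elim conjE)
  from this[rule_format, of "[seg t n m, seg t m k]" "[s0, s1]"]
  have "Sig [s0, s1] \<subseteq> Sig (seg t n k)"
    unfolding cc using c0 c1 s0(1) s1(1) composable_seg[of n k] assms(1,2) by auto
  with s assms(1,2) show ?thesis by (auto simp: pos_seg_less)
qed

lemma pos_seg_add:
  assumes "n \<le> m" "m \<le> k" "f \<in> pos n m" "g \<in> pos m k"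
  shows "f ++ g \<in> pos n k"
proof -
  consider "n = m" | "m = k" | "n < m" "m < k" using assms(1,2) by linarith
  then show ?thesis
  proof cases
    case 3
    then show ?thesis using assms(3,4) pos_seg_add_less by blast
  qed (use assms(3,4) in \<open>simp_all add: pos_seg_refl\<close>)
qed

end

section \<open>Idempotent ultrafilters and stable sets\<close>

locale idempotent_sequence = tight_sequence H K Sig t
  for H :: "nat \<Rightarrow> 'a set" and K :: "('a, 'd) creature set" and Sig t +
  fixes D :: "nat \<Rightarrow> (nat \<rightharpoonup> 'a) set set"
  assumes D_suf_plus: "D \<in> suf_plus Sig t"
    and idem: "uf_prod Sig t D D = D"
begin

abbreviation "crc \<equiv> circ Sig t"

lemma ultra: "ultrafilter_on (P n) (D n)"
  using D_suf_plus by (simp add: suf_plus_def suf_def nonprincipal_ultrafilter_on_def)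

lemma D_Int:
  assumes "A \<in> D n" "B \<in> D n"
  shows "A \<inter> B \<in> D n"
proof -
  have "\<forall>A\<in>D n. \<forall>B\<in>D n. A \<inter> B \<in> D n"
    using ultra[of n] unfolding ultrafilter_on_def by (elim conjE)
  then show ?thesis using assms by simp
qed

lemma D_mono:
  assumes "A \<in> D n" "A \<subseteq> B" "B \<subseteq> P n"
  shows "B \<in> D n"
proof -
  have "\<forall>A\<in>D n. \<forall>B. A \<subseteq> B \<and> B \<subseteq> P n \<longrightarrow> B \<in> D n"
    using ultra[of n] unfolding ultrafilter_on_def by (elim conjE)
  then show ?thesis using assms by simp
qed

lemma D_finite_Int:
  assumes "finite I" "A \<in> D n" "\<And>i. i \<in> I \<Longrightarrow> F i \<in> D n"
  shows "A \<inter> (\<Inter>i\<in>I. F i) \<in> D n"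
  using assms(1,3)
proof (induction I)
  case empty
  then show ?case using assms(2) by simp
next
  case (insert i I)
  then have "F i \<inter> (A \<inter> (\<Inter>i\<in>I. F i)) \<in> D n" using D_Int by simp
  then show ?case by (simp add: Int_left_commute)
qed

lemma set_op_in: "A \<in> D n \<Longrightarrow> set_op Sig t n A D \<in> D n"
  using fun_cong[OF idem, of n] by (auto simp: uf_prod_def)

text \<open>In a semigroup with idempotent ultrafilter p, this is the property of the set of those a
  in A whose translate of A by a lies in p: all of its own translates by its members lie in p
  again.\<close>

definition stable :: "nat \<Rightarrow> (nat \<rightharpoonup> 'a) set \<Rightarrow> bool" where
  "stable n B \<longleftrightarrow> B \<in> D n \<and> (\<forall>f\<in>B. crc n f B \<in> D (x n f))"

lemma stable_Int_set_op:
  assumes A: "A \<in> D n"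
  shows "stable n (A \<inter> set_op Sig t n A D)"
  unfolding stable_def
proof (intro conjI ballI)
  let ?B = "A \<inter> set_op Sig t n A D"
  show "?B \<in> D n" using A set_op_in D_Int by blast
  fix f assume "f \<in> ?B"
  then have f: "f \<in> P n" and C: "crc n f A \<in> D (x n f)" by (auto simp: set_op_def)
  let ?m = "x n f" and ?C = "crc n f A"
  have "?C \<inter> set_op Sig t ?m ?C D \<subseteq> crc n f ?B"
  proof
    fix g assume "g \<in> ?C \<inter> set_op Sig t ?m ?C D"
    then have g: "g \<in> P ?m" "f ++ g \<in> A" "crc ?m g ?C \<in> D (x ?m g)"
      by (auto simp: circ_def set_op_def)
    have lt: "n < ?m" "?m < x ?m g" using f g(1) pos_ttE by blast+
    then have fg: "f ++ g \<in> pos n (x ?m g)"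
      using f g(1) by (meson pos_ttE pos_seg_add_less)
    \<comment> \<open>Seen from \<open>n\<close>, \<open>f ++ g\<close> ends where \<open>g\<close>
      ends seen from \<open>?m\<close>. Hence both derived sets below live at the same level, and by
      associativity of \<open>++\<close> one contains the other.\<close>
    have xfg: "x n (f ++ g) = x ?m g" using xend_eq[OF _ fg] lt by simp
    have "crc ?m g ?C \<subseteq> crc n (f ++ g) A"
      by (auto simp: circ_def xfg)
    then have "crc n (f ++ g) A \<in> D (x n (f ++ g))"
      using D_mono[OF g(3)] by (auto simp: circ_def xfg)
    moreover have "f ++ g \<in> P n" using fg lt pos_seg_subset by (meson less_trans subsetD)
    ultimately show "g \<in> crc n f ?B"
      using g(1,2) by (simp add: circ_def set_op_def)
  qed
  then show "crc n f ?B \<in> D ?m"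
    using D_mono[OF D_Int[OF C set_op_in[OF C]]] by (auto simp: circ_def)
qed

lemma large_block:
  fixes M :: real
  assumes B: "B \<in> D n"
  obtains i1 i2 i3 g0 s g2 where
    "n \<le> i1" "i1 < i2" "i2 \<le> i3" "g0 \<in> pos n i1" "g2 \<in> pos i2 i3"
    "s \<in> Sig (seg t i1 i2)" "nor s \<ge> M"
    "\<And>g1. g1 \<in> val s \<Longrightarrow> g0 ++ g1 ++ g2 \<in> B \<and> x n (g0 ++ g1 ++ g2) = i3"
proof -
  have "P n - B \<notin> D n"
  proof
    assume "P n - B \<in> D n"
    from D_Int[OF this B] show False
      using ultra[of n] by (simp add: ultrafilter_on_def Int_commute)
  qed
  then have "P n - B \<notin> C_family Sig t n"
    using D_suf_plus by (auto simp: suf_plus_def)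
  \<comment> \<open>Lying outside \<open>C_family\<close> means that no bound works for
    \<open>P n - B\<close>, in particular not the given \<open>M\<close>.\<close>
  then have "\<not> (\<forall>i1 i2 i3. n \<le> i1 \<and> i1 < i2 \<and> i2 \<le> i3 \<longrightarrow>
      (\<forall>g0\<in>pos n i1. \<forall>g2\<in>pos i2 i3. \<forall>s\<in>Sig (seg t i1 i2). nor s \<ge> M \<longrightarrow>
        (P n - B) \<inter> {g0 ++ g1 ++ g2 | g1. g1 \<in> val s} \<noteq> {}))"
    unfolding C_family_def mem_Collect_eq using Diff_subset by (elim contrapos_nn) (intro conjI exI)
  then obtain i1 i2 i3 g0 s g2 where *:
    "n \<le> i1" "i1 < i2" "i2 \<le> i3" "g0 \<in> pos n i1" "g2 \<in> pos i2 i3"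
    "s \<in> Sig (seg t i1 i2)" "nor s \<ge> M"
    and disj: "(P n - B) \<inter> {g0 ++ g1 ++ g2 | g1. g1 \<in> val s} = {}"
    by (simp only: not_all not_imp ball_simps(10) not_not) (elim exE conjE bexE, rule that)
  have "g0 ++ g1 ++ g2 \<in> B \<and> x n (g0 ++ g1 ++ g2) = i3" if g1: "g1 \<in> val s" for g1
  proof -
    have "g1 \<in> pos i1 i2" using * g1 by (auto simp: pos_seg_less)
    then have "g0 ++ g1 \<in> pos n i2" using * by (intro pos_seg_add[of n i1 i2]) auto
    then have "g0 ++ g1 ++ g2 \<in> pos n i3" using * by (intro pos_seg_add[of n i2 i3]) auto
    moreover have "n < i3" using * by linarith
    ultimately have "x n (g0 ++ g1 ++ g2) = i3" "g0 ++ g1 ++ g2 \<in> P n"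
      using xend_eq pos_seg_subset by blast+
    then show ?thesis using disj g1 by blast
  qed
  with * show ?thesis by (rule that)
qed

text \<open>Every filling of the block lies in \<open>B\<close>, and appending any member of
  \<open>B'\<close> to it stays in \<open>B\<close>. Since \<open>B'\<close> does not depend on
  \<open>g1\<close>, the construction can continue before \<open>g1\<close> is chosen.\<close>

definition block where
  "block n B i1 i2 i3 g0 s g2 M B' \<longleftrightarrow>
    n \<le> i1 \<and> i1 < i2 \<and> i2 \<le> i3 \<and> g0 \<in> pos n i1 \<and> g2 \<in> pos i2 i3 \<and>
    s \<in> Sig (seg t i1 i2) \<and> nor s \<ge> (M::real) \<and>
    (\<forall>g1\<in>val s. g0 ++ g1 ++ g2 \<in> B \<and> B' \<subseteq> crc n (g0 ++ g1 ++ g2) B)"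

lemma stable_step:
  assumes B: "stable n B" and A: "\<And>n. A n \<in> D n"
  shows "\<exists>i1 i2 i3 g0 s g2 B'. stable i3 B' \<and> B' \<subseteq> A i3 \<and> block n B i1 i2 i3 g0 s g2 M B'"
proof -
  obtain i1 i2 i3 g0 s g2 where *:
    "n \<le> i1" "i1 < i2" "i2 \<le> i3" "g0 \<in> pos n i1" "g2 \<in> pos i2 i3"
    "s \<in> Sig (seg t i1 i2)" "nor s \<ge> M"
    and g1: "\<And>g1. g1 \<in> val s \<Longrightarrow> g0 ++ g1 ++ g2 \<in> B \<and> x n (g0 ++ g1 ++ g2) = i3"
    using B[unfolded stable_def, THEN conjunct1] by (rule large_block[where M = M]) (rule that)
  \<comment> \<open>All fillings end at the same \<open>i3\<close>, so these sets belong to one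
    ultrafilter \<open>D i3\<close>; finiteness of \<open>val s\<close> keeps the intersection in
    it.\<close>
  define E where "E = A i3 \<inter> (\<Inter>g1\<in>val s. crc n (g0 ++ g1 ++ g2) B)"
  have "crc n (g0 ++ g1 ++ g2) B \<in> D i3" if "g1 \<in> val s" for g1
    using g1[OF that] B unfolding stable_def by metis
  then have "E \<in> D i3"
    unfolding E_def using A finite_val[OF *(2,6)] by (intro D_finite_Int)
  then have "stable i3 (E \<inter> set_op Sig t i3 E D)"
    by (rule stable_Int_set_op)
  moreover have "block n B i1 i2 i3 g0 s g2 M (E \<inter> set_op Sig t i3 E D)"
    unfolding block_def
  proof (intro conjI ballI)
    show "E \<inter> set_op Sig t i3 E D \<subseteq> crc n (g0 ++ g1 ++ g2) B" if "g1 \<in> val s" for g1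
      unfolding E_def using that by blast
  qed (use * g1 in simp_all)
  moreover have "E \<inter> set_op Sig t i3 E D \<subseteq> A i3"
    by (simp add: E_def le_infI1)
  ultimately show ?thesis by blast
qed

end

section \<open>Recursive choice of the blocks\<close>

theorem theorem4p6:
  fixes H :: "nat \<Rightarrow> 'a set"
    and K :: "('a, 'd) creature set"
    and Sig :: "('a, 'd) creature list \<Rightarrow> ('a, 'd) creature set"
    and t :: "nat \<Rightarrow> ('a, 'd) creature"
    and D :: "nat \<Rightarrow> (nat \<rightharpoonup> 'a) set set"
    and A :: "nat \<Rightarrow> (nat \<rightharpoonup> 'a) set"
  assumes "\<And>i. finite (H i) \<and> H i \<noteq> {}"
    and "tight_FFCC H K Sig"
    and "t \<in> PC_tt K"
    and "D \<in> suf_plus Sig t"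
    and "uf_prod Sig t D D = D"
    and "\<And>n. A n \<in> D n"
  shows "\<exists>(n :: nat \<Rightarrow> nat) (g :: nat \<Rightarrow> (nat \<rightharpoonup> 'a)) (s :: nat \<Rightarrow> ('a, 'd) creature).
    \<forall>i.
      (0 = n 0 \<and> n 0 \<le> n (3*i) \<and> n (3*i) \<le> n (3*i+1) \<and> n (3*i+1) < n (3*i+2) \<and>
       n (3*i+2) \<le> n (3*i+3)) \<and>
      (\<forall>j. j = 3*i \<or> j = 3*i+2 \<longrightarrow> g j \<in> pos_seg Sig t (n j) (n (j+1))) \<and>
      (\<forall>j. j = 3*i+1 \<longrightarrow> s j \<in> Sig (seg t (n j) (n (j+1))) \<and> nor (s j) \<ge> real j) \<and>
      (\<forall>k h. i < k \<and> (\<forall>l\<in>{i..<k}. h (3*l+1) \<in> val (s (3*l+1))) \<longrightarrow>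
         seq_union (\<lambda>j. if j mod 3 = 1 then h j else g j) (3*i) (3*k) \<in> A (n (3*i)))"
proof -
  interpret idempotent_sequence H K Sig t D
    by (intro idempotent_sequence.intro tight_sequence.intro idempotent_sequence_axioms.intro assms(2-5))
  \<comment> \<open>A state of the recursion is a pair of a level and a stable set at that level.
    The norm bound \<open>3*i+1\<close> is the index that the creature of block \<open>i\<close>
    will carry.\<close>
  define R where "R i p q \<longleftrightarrow> (\<exists>i1 i2 g0 s g2.
      block (fst p) (snd p) i1 i2 (fst q) g0 s g2 (real (3*i+1)) (snd q))" for i p q
  define Inv where "Inv i p \<longleftrightarrow> stable (fst p) (snd p) \<and> snd p \<subseteq> A (fst p) \<and> (i = 0 \<longrightarrow> fst p = 0)"
    for i :: nat and p
  have "\<exists>p. \<forall>i. Inv i (p i) \<and> R i (p i) (p (Suc i))"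
  proof (rule dependent_nat_choice)
    show "\<exists>p. Inv 0 p"
      using stable_Int_set_op[OF assms(6)[of 0]] unfolding Inv_def
      by (metis Int_lower1 fst_conv snd_conv)
    show "\<exists>q. Inv (Suc i) q \<and> R i p q" if inv: "Inv i p" for p i
    proof -
      obtain i1 i2 i3 g0 s g2 B' where "stable i3 B'" "B' \<subseteq> A i3"
        "block (fst p) (snd p) i1 i2 i3 g0 s g2 (real (3*i+1)) B'"
        using stable_step[of "fst p" "snd p" A, OF _ assms(6)] inv[unfolded Inv_def] by blast
      then have "Inv (Suc i) (i3, B') \<and> R i p (i3, B')"
        unfolding Inv_def R_def fst_conv snd_conv by blast
      then show ?thesis by blast
    qed
  qed
  then obtain p where Inv: "\<And>i. Inv i (p i)" and R: "\<And>i. R i (p i) (p (Suc i))"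
    by blast
  define N where "N i = fst (p i)" for i
  define B where "B i = snd (p i)" for i
  have N0: "N 0 = 0" and BA: "\<And>i. B i \<subseteq> A (N i)"
    using Inv by (auto simp: Inv_def N_def B_def)
  \<comment> \<open>\<open>R\<close> only asserts that a block exists between consecutive states;
    its parts are now chosen as functions of \<open>i\<close>.\<close>
  have "\<forall>i. \<exists>i1 i2 g0 s g2. block (N i) (B i) i1 i2 (N (Suc i)) g0 s g2 (real (3*i+1)) (B (Suc i))"
    using R by (simp add: R_def N_def B_def)
  from this[unfolded choice_iff] obtain i1 i2 g0 s g2 where
    blk: "\<And>i. block (N i) (B i) (i1 i) (i2 i) (N (Suc i)) (g0 i) (s i) (g2 i) (real (3*i+1)) (B (Suc i))"
    by blast
  \<comment> \<open>The block data are interleaved: block \<open>i\<close> occupies the indices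
    \<open>3*i\<close>, \<open>3*i+1\<close>, \<open>3*i+2\<close>, and its successor starts at
    \<open>N (Suc i)\<close>.\<close>
  define n where "n j = (if j mod 3 = 0 then N else if j mod 3 = 1 then i1 else i2) (j div 3)" for j
  define g where "g j = (if j mod 3 = 0 then g0 else g2) (j div 3)" for j
  have n_simps: "n (3*i) = N i" "n (Suc (3*i)) = i1 i" "n (Suc (Suc (3*i))) = i2 i"
      "n (Suc (Suc (Suc (3*i)))) = N (Suc i)" for i
  proof -
    have "Suc (3*i) mod 3 = 1" "Suc (Suc (3*i)) mod 3 = 2" "Suc (3*i) div 3 = i"
      "Suc (Suc (3*i)) div 3 = i" "Suc (Suc (Suc (3*i))) = 3 * Suc i" by presburger+
    then show "n (3*i) = N i" "n (Suc (3*i)) = i1 i" "n (Suc (Suc (3*i))) = i2 i"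
      "n (Suc (Suc (Suc (3*i)))) = N (Suc i)" by (simp_all add: n_def)
  qed
  have g_simps: "g (3*i) = g0 i" "g (Suc (Suc (3*i))) = g2 i" for i
  proof -
    have "Suc (Suc (3*i)) mod 3 = 2" "Suc (Suc (3*i)) div 3 = i" by presburger+
    then show "g (3*i) = g0 i" "g (Suc (Suc (3*i))) = g2 i" by (simp_all add: g_def)
  qed
  \<comment> \<open>Downward induction on \<open>i\<close>: a union from \<open>B (Suc i)\<close> is
    prefixed by a filling of block \<open>i\<close>, which leads into \<open>B i\<close>. The last
    block starts the induction, because the empty union after it is no member of
    \<open>B k\<close>.\<close>
  have union: "seq_union (\<lambda>j. if j mod 3 = 1 then h j else g j) (3*i) (3*k) \<in> B i"
    if "i < k" "\<forall>l\<in>{i..<k}. h (3*l+1) \<in> val (s l)" for i k h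
    using that
  proof (induction i rule: strict_inc_induct)
    case (base i)
    let ?G = "\<lambda>j. if j mod 3 = 1 then h j else g j"
    have "Suc (3*i) mod 3 = 1" "Suc (Suc (3*i)) mod 3 = 2" for i :: nat by presburger+
    then have "seq_union ?G (3*i) (3*k) = g0 i ++ h (3*i+1) ++ g2 i ++ seq_union ?G (3 * k) (3*k)"
      using seq_union_block[of i k ?G] base by (simp add: g_simps)
    then show ?case
      using blk[of i] base by (simp add: block_def seq_union_def)
  next
    case (step i)
    let ?G = "\<lambda>j. if j mod 3 = 1 then h j else g j"
    have "Suc (3*i) mod 3 = 1" "Suc (Suc (3*i)) mod 3 = 2" by presburger+
    then have "seq_union ?G (3*i) (3*k) = g0 i ++ h (3*i+1) ++ g2 i ++ seq_union ?G (3 * Suc i) (3*k)"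
      using seq_union_block[of i k ?G] step.hyps by (simp add: g_simps)
    moreover have "seq_union ?G (3 * Suc i) (3*k) \<in> B (Suc i)"
      using step by simp
    moreover have "h (3*i+1) \<in> val (s i)"
      using step by simp
    ultimately show ?case
      using blk[of i] by (auto simp: block_def circ_def)
  qed
  show ?thesis
  proof (intro exI[of _ n] exI[of _ g] exI[of _ "\<lambda>j. s (j div 3)"] allI conjI impI)
    fix i
    have d: "Suc (3*i) div 3 = i" for i :: nat by presburger
    have b: "N i \<le> i1 i" "i1 i < i2 i" "i2 i \<le> N (Suc i)"
      "g0 i \<in> pos (N i) (i1 i)" "g2 i \<in> pos (i2 i) (N (Suc i))"
      "s i \<in> Sig (seg t (i1 i) (i2 i))" "nor (s i) \<ge> real (3*i+1)"
      using blk[of i] by (auto simp: block_def)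
    show "0 = n 0" "n 0 \<le> n (3*i)" using n_simps(1)[of 0] N0 by simp_all
    show "n (3*i) \<le> n (3*i+1)" "n (3*i+1) < n (3*i+2)" "n (3*i+2) \<le> n (3*i+3)"
      using b n_simps(1)[of "Suc i"] by (simp_all add: n_simps add.commute)
    show "g j \<in> pos_seg Sig t (n j) (n (j+1))" if "j = 3*i \<or> j = 3*i+2" for j
      using that b by (auto simp: n_simps g_simps)
    show "s (j div 3) \<in> Sig (seg t (n j) (n (j+1)))" "real j \<le> nor (s (j div 3))"
      if "j = 3*i+1" for j
      using that b by (auto simp: n_simps d)
    show "seq_union (\<lambda>j. if j mod 3 = 1 then h j else g j) (3*i) (3*k) \<in> A (n (3*i))"
      if "i < k \<and> (\<forall>l\<in>{i..<k}. h (3*l+1) \<in> val (s ((3*l+1) div 3)))" for k h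
      using union[of i k h] that BA[of i] by (auto simp: n_simps d)
  qed
qed

end
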